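(* Let $G$ be a graph of order $n\ge 4$ such that both $G$ and its complement $\overline G$ are connected. Then: (1) $\operatorname{th}_{\operatorname{Z}}(G)+\operatorname{th}_{\operatorname{Z}}(\overline G)\le 2(n-1)$ and $\operatorname{th}_{\operatorname{Z}}(G)\cdot\operatorname{th}_{\operatorname{Z}}(\overline G)\le (n-1)^2$. (2) $\operatorname{th}_{\operatorname{Z}}^{\ast}(G)+\operatorname{th}_{\operatorname{Z}}^{\ast}(\overline G)\le 2(n-2)$ and $\operatorname{th}_{\operatorname{Z}}^{\ast}(G)\cdot\operatorname{th}_{\operatorname{Z}}^{\ast}(\overline G)\le (n-2)^2$. All bounds are sharp, i.e., each is attained by infinitely many graphs $G$ such that both $G$ and $\overline G$ are connected.
   Context: Graphs are finite, simple, undirected, with nonempty vertex set; the order of $G$ is $|V(G)|$; $\overline G$ is the complement of $G$. Standard zero forcing: each vertex is filled or unfilled. Color change rule: if $w$ is the unique unfilled neighbor of a filled vertex $v$, then fill $w$. For $B\subseteq V(G)$ put $B^{[0]}=B$, and let $B^{[i+1]}$ be $B^{[i]}$ together with all vertices that can be filled by one application of the rule when exactly the vertices of $B^{[i]}$ are filled. $\operatorname{pt}_{\operatorname{Z}}(G;B)$ is the least $t$ with $B^{[t]}=V(G)$ ($\infty$ if none exists), and $\operatorname{pt}_{\operatorname{Z}}(G,k)=\min_{|B|=k}\operatorname{pt}_{\operatorname{Z}}(G;B)$. For $G$ of order $n$: the sum throttling number is $\operatorname{th}_{\operatorname{Z}}(G)=\min_{1\le k\le n}(k+\operatorname{pt}_{\operatorname{Z}}(G,k))$,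 and, if $G$ has an edge, the no initial cost product throttling number is $\operatorname{th}_{\operatorname{Z}}^{\ast}(G)=\min_{1\le k\le n-1}k\cdot\operatorname{pt}_{\operatorname{Z}}(G,k)$. *)

theory Defs
  imports "Graph_Theory.Graph_Theory" "HOL-Library.Extended_Nat"
begin

text \<open>
  A finite simple undirected graph is a \<open>pair_graph\<close>: finite vertex set, and an irreflexive
  symmetric arc set, so that the arcs \<open>(u, v)\<close> and \<open>(v, u)\<close> together represent the edge \<open>uv\<close>.
  Nonemptiness of the vertex set is part of the predicate \<open>connected\<close>.
\<close>

definition graph_complement :: "'a pair_pre_digraph \<Rightarrow> 'a pair_pre_digraph" where
  "graph_complement G =
    \<lparr> pverts = pverts G,
      parcs = {(u, v). u \<in> pverts G \<and> v \<in> pverts G \<and> u \<noteq> v \<and> (u, v) \<notin> parcs G} \<rparr>"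

definition neighbors :: "'a pair_pre_digraph \<Rightarrow> 'a \<Rightarrow> 'a set" where
  "neighbors G v = {w. (v, w) \<in> parcs G}"

definition can_fill :: "'a pair_pre_digraph \<Rightarrow> 'a set \<Rightarrow> 'a \<Rightarrow> bool" where
  "can_fill G B w \<longleftrightarrow> (\<exists>v\<in>B. neighbors G v - B = {w})"

primrec filled_after :: "'a pair_pre_digraph \<Rightarrow> 'a set \<Rightarrow> nat \<Rightarrow> 'a set" where
  "filled_after G B 0 = B"
| "filled_after G B (Suc i) = filled_after G B i \<union> {w. can_fill G (filled_after G B i) w}"

text \<open>
  All minima are infima in \<open>enat\<close>; the infimum of the empty set is \<open>\<infinity>\<close>, and the infimum of a
  nonempty set is its least element.
\<close>

definition pt_set :: "'a pair_pre_digraph \<Rightarrow> 'a set \<Rightarrow> enat" where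
  "pt_set G B = (INF t \<in> {t. filled_after G B t = pverts G}. enat t)"

definition pt :: "'a pair_pre_digraph \<Rightarrow> nat \<Rightarrow> enat" where
  "pt G k = (INF B \<in> {B. B \<subseteq> pverts G \<and> card B = k}. pt_set G B)"

definition th :: "'a pair_pre_digraph \<Rightarrow> enat" where
  "th G = (INF k \<in> {1..card (pverts G)}. enat k + pt G k)"

text \<open>Only meaningful for graphs with an edge; otherwise the value is \<open>\<infinity>\<close>.\<close>

definition th_star :: "'a pair_pre_digraph \<Rightarrow> enat" where
  "th_star G = (INF k \<in> {1..card (pverts G) - 1}. enat k * pt G k)"

definition co_connected_graph :: "'a pair_pre_digraph \<Rightarrow> bool" where
  "co_connected_graph G \<longleftrightarrow>
    pair_graph G \<and> connected (with_proj G) \<and> connected (with_proj (graph_complement G))"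

text \<open>
  Graphs are counted up to isomorphism. Every finite graph is isomorphic to one whose vertices are
  natural numbers, so it suffices to let the family range over these.
\<close>

definition infinitely_many_graphs :: "(nat pair_pre_digraph \<Rightarrow> bool) \<Rightarrow> bool" where
  "infinitely_many_graphs P \<longleftrightarrow>
    (\<exists>S. infinite S \<and> (\<forall>G\<in>S. P G) \<and>
      (\<forall>G\<in>S. \<forall>H\<in>S. G \<noteq> H \<longrightarrow> \<not> digraph_iso (with_proj G) (with_proj H)))"

end

theory Submission
  imports Defs
begin

text \<open>
  If two vertices \<open>b\<close>, \<open>c\<close> have incomparable neighborhoods, witnessed by \<open>a\<close> and \<open>d\<close>, then filling
  everything except \<open>b\<close> and \<open>c\<close> forces both in one step. Such a configuration survives
  complementation, and it can only be missing if a vertex of maximum degree is dominating, i.e.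
  isolated in the complement. Sharpness is witnessed by the path on four vertices with one end
  blown up to an independent set \<open>L\<close> of twins: a zero forcing set misses at most one vertex of \<open>L\<close>,
  and in one step all filled twins together fill at most one vertex.
\<close>

section \<open>Connectedness\<close>

lemma pair_graph_complement:
  assumes "pair_graph G"
  shows "pair_graph (graph_complement G)"
proof -
  interpret pair_graph G by fact
  have "parcs (graph_complement G) \<subseteq> pverts G \<times> pverts G"
    by (auto simp: graph_complement_def)
  then have "finite (parcs (graph_complement G))"
    using finite_subset pair_finite_verts by blast
  then show ?thesis
    by unfold_locales
      (auto simp: graph_complement_def symmetric_def sym_def pair_finite_verts arcs_symmetric)
qed

text \<open>Since arcs come in symmetric pairs, walks into one root can be reversed and joined. This
  leaves one walk per vertex to exhibit when a concrete graph is checked.\<close>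

lemma connected_pair_graphI:
  assumes "pair_graph G" and r: "r \<in> pverts G"
    and to_r: "\<And>v. v \<in> pverts G \<Longrightarrow> (v, r) \<in> (parcs G)\<^sup>*"
  shows "connected (with_proj G)"
proof -
  interpret pair_graph G by fact
  have sym: "sym (parcs G)"
    using pair_sym_arcs by (simp add: symmetric_def)
  have sub: "parcs G \<inter> pverts G \<times> pverts G = parcs G"
    using wellformed' by auto
  have "u \<rightarrow>\<^sup>*\<^bsub>with_proj G\<^esub> v" if "u \<in> pverts G" "v \<in> pverts G" for u v
  proof -
    have "(r, v) \<in> (parcs G)\<^sup>*"
      using to_r[OF that(2)] sym_rtrancl[OF sym] by (auto dest: symD)
    then have "(u, v) \<in> (parcs G)\<^sup>*"
      using to_r[OF that(1)] by simp
    then show ?thesis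
      using that by (simp add: reachable_conv sub)
  qed
  then show ?thesis
    using r reachable_mk_symmetric_eq[OF pair_sym_arcs]
    by (auto simp: connected_def strongly_connected_def mk_symmetric_def)
qed

lemma connected_imp_adjacent:
  assumes "pair_graph G" "connected (with_proj G)" "u \<in> pverts G" "v \<in> pverts G" "u \<noteq> v"
  obtains w where "(u, w) \<in> parcs G"
proof -
  interpret pair_graph G by fact
  have "u \<rightarrow>\<^sup>*\<^bsub>with_proj G\<^esub> v"
    using symmetric_connected_imp_strongly_connected[OF pair_sym_arcs assms(2)] assms(3,4)
    by (auto simp: strongly_connected_def)
  then have "(u, v) \<in> (parcs G)\<^sup>*"
    using reachable_rtranclI by auto
  then show thesis
    using \<open>u \<noteq> v\<close> that by (auto elim: converse_rtranclE)
qed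

section \<open>Upper bounds\<close>

text \<open>This is an alternating 4-cycle \<open>a b d c\<close>, in which edges and nonedges take
  turns. The pairs \<open>a d\<close> and \<open>b c\<close> are left unconstrained. The graphs
  without such a cycle are the threshold graphs.\<close>

definition alternating :: "'a pair_pre_digraph \<Rightarrow> 'a \<Rightarrow> 'a \<Rightarrow> 'a \<Rightarrow> 'a \<Rightarrow> bool" where
  "alternating G a b c d \<longleftrightarrow>
    distinct [a, b, c, d] \<and> {a, b, c, d} \<subseteq> pverts G \<and>
    (a, b) \<in> parcs G \<and> (d, c) \<in> parcs G \<and> (a, c) \<notin> parcs G \<and> (d, b) \<notin> parcs G"

text \<open>Complementation exchanges the edges and nonedges of the alternating cycle, so
  \<open>b\<close> and \<open>c\<close> swap roles.\<close>

lemma alternating_complement: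
  "alternating G a b c d \<Longrightarrow> alternating (graph_complement G) a c b d"
  by (auto simp: alternating_def graph_complement_def)

text \<open>A vertex \<open>v\<close> of maximum degree has a non-neighbor \<open>u\<close> because
  the complement is connected, and \<open>u\<close> has a neighbor \<open>w\<close> because
  \<open>G\<close> is. Maximality then yields the fourth vertex: a neighbor of \<open>v\<close>
  missed by \<open>u\<close> if \<open>v w\<close> is a nonedge, and one missed by \<open>w\<close>
  if it is an edge.\<close>

lemma co_connected_alternating:
  assumes co: "co_connected_graph G" and card: "card (pverts G) \<ge> 2"
  obtains a b c d where "alternating G a b c d"
proof -
  have G: "pair_graph G" and conn: "connected (with_proj G)"
    and cconn: "connected (with_proj (graph_complement G))"
    using co by (auto simp: co_connected_graph_def)
  interpret pair_graph G by fact
  let ?N = "neighbors G"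
  have finN: "finite (?N v)" for v
    by (rule finite_subset[OF _ pair_finite_verts]) (auto simp: neighbors_def dest: wellformed')
  obtain v where v: "v \<in> pverts G" and maxv: "\<And>u. u \<in> pverts G \<Longrightarrow> card (?N u) \<le> card (?N v)"
  proof -
    have ne: "pverts G \<noteq> {}" using card by auto
    let ?d = "\<lambda>u. card (?N u)"
    have "Max (?d ` pverts G) \<in> ?d ` pverts G"
      using ne pair_finite_verts by (intro Max_in) auto
    then obtain v where v: "Max (?d ` pverts G) = ?d v" "v \<in> pverts G"
      by (rule imageE)
    show thesis
    proof (rule that[OF v(2)])
      show "?d u \<le> ?d v" if "u \<in> pverts G" for u
        unfolding v(1)[symmetric] using that pair_finite_verts by (intro Max_ge) auto
    qed
  qed
  obtain x where "x \<in> pverts G" "x \<noteq> v"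
    using card v pair_finite_verts
    by (metis card_le_Suc0_iff_eq not_less_eq_eq numeral_2_eq_2)
  then obtain u where "(v, u) \<in> parcs (graph_complement G)"
    using connected_imp_adjacent[OF pair_graph_complement[OF G] cconn]
    using v by (auto simp: graph_complement_def)
  then have u: "u \<in> pverts G" "u \<noteq> v" "(v, u) \<notin> parcs G" "(u, v) \<notin> parcs G"
    using arcs_symmetric by (auto simp: graph_complement_def)
  obtain w where uw: "(u, w) \<in> parcs G"
    using connected_imp_adjacent[OF G conn u(1) v u(2)] by blast
  then have w: "w \<in> pverts G" "w \<noteq> u" "w \<noteq> v" "(w, u) \<in> parcs G"
    using u no_loops' arcs_symmetric by (auto dest: wellformed')
  show thesis
  proof (cases "(v, w) \<in> parcs G")
    case False
    \<comment> \<open>The inclusion would be strict, as \<open>w\<close> is adjacent to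
      \<open>u\<close> but not to \<open>v\<close>, so \<open>u\<close> would have larger degree
      than \<open>v\<close>.\<close>
    have "\<not> ?N v \<subseteq> ?N u"
    proof
      assume "?N v \<subseteq> ?N u"
      then have "?N v \<subset> ?N u" using uw False by (auto simp: neighbors_def)
      from psubset_card_mono[OF finN this] show False using maxv[OF u(1)] by simp
    qed
    then obtain y where y: "(v, y) \<in> parcs G" "(u, y) \<notin> parcs G"
      by (auto simp: neighbors_def)
    then have "(y, v) \<in> parcs G" "(y, u) \<notin> parcs G" "(w, v) \<notin> parcs G" "y \<in> pverts G" "y \<noteq> v"
      using False arcs_symmetric no_loops'[of v y] by (blast dest: wellformed')+
    then have "alternating G w u v y"
      using y u w False v unfolding alternating_def by auto
    then show thesis by (rule that)
  next
    case True
    \<comment> \<open>Here \<open>w\<close> is also adjacent to \<open>v\<close> and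
      \<open>u\<close>, neither of which is a neighbor of \<open>v\<close>; the inclusion would make
      the degree of \<open>w\<close> at least one more than that of \<open>v\<close>.\<close>
    have "\<not> ?N v - {w} \<subseteq> ?N w"
    proof
      assume sub: "?N v - {w} \<subseteq> ?N w"
      have "insert v (insert u (?N v - {w})) \<subseteq> ?N w"
        using sub True w arcs_symmetric by (auto simp: neighbors_def)
      then have "card (insert v (insert u (?N v - {w}))) \<le> card (?N w)"
        using finN by (rule card_mono[rotated])
      moreover have "card (insert v (insert u (?N v - {w}))) = card (?N v - {w}) + 2"
      proof -
        have "v \<notin> ?N v" "u \<notin> ?N v"
          using u no_loops'[of v v] by (auto simp: neighbors_def)
        then show ?thesis
          using finN[of v] u(2) by simp
      qed
      moreover have "card (?N v - {w}) + 1 = card (?N v)"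
        using True finN[of v] card_Suc_Diff1[of "?N v" w] by (simp add: neighbors_def)
      ultimately show False using maxv[OF w(1)] by simp
    qed
    then obtain y where y: "(v, y) \<in> parcs G" "(w, y) \<notin> parcs G" "y \<noteq> w"
      by (auto simp: neighbors_def)
    then have "(y, v) \<in> parcs G" "(y, w) \<notin> parcs G" "y \<in> pverts G" "y \<noteq> v"
      using arcs_symmetric no_loops'[of v y] by (blast dest: wellformed')+
    then have "alternating G u w v y"
      using y u uw w v unfolding alternating_def by auto
    then show thesis by (rule that)
  qed
qed

lemma alternating_pt_le_1:
  assumes "pair_graph G" and alt: "alternating G a b c d"
  shows "pt G (card (pverts G) - 2) \<le> 1"
proof -
  interpret pair_graph G by fact
  let ?B = "pverts G - {b, c}"
  \<comment> \<open>Only \<open>b\<close> and \<open>c\<close> are unfilled, and the two nonedges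
    hide \<open>c\<close> from \<open>a\<close> and \<open>b\<close> from \<open>d\<close>.\<close>
  have "neighbors G a - ?B = {b}" "neighbors G d - ?B = {c}"
    using alt by (auto simp: neighbors_def alternating_def dest: wellformed')
  moreover have "a \<in> ?B" "d \<in> ?B"
    using alt by (auto simp: alternating_def)
  ultimately have "can_fill G ?B b" "can_fill G ?B c"
    by (auto simp: can_fill_def)
  moreover have "w \<in> pverts G" if "can_fill G ?B w" for w
    using that by (auto simp: can_fill_def neighbors_def dest: wellformed')
  ultimately have "filled_after G ?B 1 = pverts G"
    by auto
  then have "pt_set G ?B \<le> enat 1"
    unfolding pt_set_def by (intro INF_lower) simp
  moreover have "card ?B = card (pverts G) - 2"
    using alt by (subst card_Diff_subset) (auto simp: alternating_def)
  then have "pt G (card (pverts G) - 2) \<le> pt_set G ?B"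
    unfolding pt_def by (intro INF_lower) auto
  ultimately show ?thesis
    by (simp add: one_enat_def)
qed

text \<open>Both minima are tested at \<open>n - 2\<close> initial vertices, where one round
  suffices.\<close>

lemma th_le_if_alternating:
  assumes "pair_graph G" "alternating G a b c d" "card (pverts G) = n" "n \<ge> 4"
  shows "th G \<le> enat (n - 1)" "th_star G \<le> enat (n - 2)"
proof -
  have pt: "pt G (n - 2) \<le> 1"
    using alternating_pt_le_1[OF assms(1,2)] assms(3) by simp
  have "th G \<le> enat (n - 2) + pt G (n - 2)"
    unfolding th_def using assms by (intro INF_lower) auto
  also have "\<dots> \<le> enat (n - 2) + 1"
    using pt by (rule add_left_mono)
  also have "\<dots> = enat (n - 1)"
    using assms(4) by (simp add: one_enat_def)
  finally show "th G \<le> enat (n - 1)" .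
  have "th_star G \<le> enat (n - 2) * pt G (n - 2)"
    unfolding th_star_def using assms by (intro INF_lower) auto
  also have "\<dots> \<le> enat (n - 2) * 1"
    using pt by (rule mult_left_mono) simp
  finally show "th_star G \<le> enat (n - 2)" by simp
qed

lemma co_connected_th_le:
  assumes "co_connected_graph G" "card (pverts G) = n" "n \<ge> 4"
  shows "th G \<le> enat (n - 1)" "th (graph_complement G) \<le> enat (n - 1)"
    and "th_star G \<le> enat (n - 2)" "th_star (graph_complement G) \<le> enat (n - 2)"
proof -
  obtain a b c d where alt: "alternating G a b c d"
    by (rule co_connected_alternating[OF assms(1)]) (use assms(2,3) in simp)
  have G: "pair_graph G" using assms(1) by (simp add: co_connected_graph_def)
  show "th G \<le> enat (n - 1)" "th_star G \<le> enat (n - 2)"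
    using th_le_if_alternating[OF G alt assms(2,3)] by auto
  have "card (pverts (graph_complement G)) = n"
    using assms(2) by (simp add: graph_complement_def)
  then show "th (graph_complement G) \<le> enat (n - 1)"
    "th_star (graph_complement G) \<le> enat (n - 2)"
    using th_le_if_alternating[OF pair_graph_complement[OF G] alternating_complement[OF alt]] assms(3)
    by auto
qed

section \<open>Lower bounds from twins\<close>

text \<open>True and false twins are both allowed, so that the notion is invariant under complement.\<close>

definition twin_set :: "'a pair_pre_digraph \<Rightarrow> 'a set \<Rightarrow> bool" where
  "twin_set G L \<longleftrightarrow> L \<subseteq> pverts G \<and>
    (\<forall>a\<in>L. \<forall>b\<in>L. \<forall>v. v \<noteq> a \<and> v \<noteq> b \<longrightarrow> ((v, a) \<in> parcs G \<longleftrightarrow> (v, b) \<in> parcs G))"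

lemma twin_set_complement:
  assumes "twin_set G L"
  shows "twin_set (graph_complement G) L"
proof -
  have "(v, a) \<in> parcs (graph_complement G) \<longleftrightarrow> (v, b) \<in> parcs (graph_complement G)"
    if "a \<in> L" "b \<in> L" "v \<noteq> a \<and> v \<noteq> b" for a b v
  proof -
    have "(v, a) \<in> parcs G \<longleftrightarrow> (v, b) \<in> parcs G" "a \<in> pverts G" "b \<in> pverts G"
      using assms that unfolding twin_set_def by blast+
    then show ?thesis
      using that(3) by (simp add: graph_complement_def)
  qed
  moreover have "L \<subseteq> pverts (graph_complement G)"
    using assms by (simp add: twin_set_def graph_complement_def)
  ultimately show ?thesis
    unfolding twin_set_def by blast
qed

section \<open>Unfilled vertices in the presence of twins\<close>

lemma filled_after_mono: "B \<subseteq> filled_after G B t"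
  by (induction t) auto

lemma filled_after_subset:
  assumes "pair_graph G" "B \<subseteq> pverts G"
  shows "filled_after G B t \<subseteq> pverts G"
proof -
  interpret pair_graph G by fact
  show ?thesis
    using assms(2) by (induction t) (auto simp: can_fill_def neighbors_def dest: wellformed')
qed

text \<open>While both twins are unfilled, a filled vertex differs from each of them and so is
  adjacent to both or to neither; its set of unfilled neighbors is never just one of them.\<close>

lemma twins_stay_unfilled:
  assumes "twin_set G L" "a \<in> L" "b \<in> L" "a \<noteq> b" "a \<notin> B" "b \<notin> B"
  shows "a \<notin> filled_after G B t \<and> b \<notin> filled_after G B t"
proof (induction t)
  case 0
  then show ?case using assms by simp
next
  case (Suc t)
  let ?F = "filled_after G B t"
  have "neighbors G v - ?F \<noteq> {a} \<and> neighbors G v - ?F \<noteq> {b}" if "v \<in> ?F" for v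
  proof -
    have "v \<noteq> a" "v \<noteq> b" using Suc that by auto
    then have "(v, a) \<in> parcs G \<longleftrightarrow> (v, b) \<in> parcs G"
      using assms(1-3) unfolding twin_set_def by blast
    then have "a \<in> neighbors G v - ?F \<longleftrightarrow> b \<in> neighbors G v - ?F"
      using Suc by (simp add: neighbors_def)
    then show ?thesis using \<open>a \<noteq> b\<close> by auto
  qed
  then have "\<not> can_fill G ?F a" "\<not> can_fill G ?F b"
    by (auto simp: can_fill_def)
  then show ?case using Suc by simp
qed

text \<open>Charge each new vertex to a filled vertex that forces it. Filled twins have the same
  unfilled neighbors, so all of them together force at most one vertex, and each filled vertex
  outside \<open>L\<close> forces at most one.\<close>

lemma card_can_fill_le:
  assumes "pair_graph G" and twin: "twin_set G L" and "F \<subseteq> pverts G"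
  shows "finite {w. can_fill G F w}" "card {w. can_fill G F w} \<le> 1 + card (F - L)"
proof -
  interpret pair_graph G by fact
  have finF: "finite F" using assms(3) pair_finite_verts finite_subset by blast
  let ?P = "{w. \<exists>v\<in>F \<inter> L. neighbors G v - F = {w}}"
  \<comment> \<open>For vertices that force nothing, \<open>the_elem\<close> is unspecified; this
    only enlarges \<open>?Q\<close>, which serves as an upper bound.\<close>
  let ?Q = "(\<lambda>v. the_elem (neighbors G v - F)) ` (F - L)"
  have sub: "{w. can_fill G F w} \<subseteq> ?P \<union> ?Q"
  proof
    fix w assume "w \<in> {w. can_fill G F w}"
    then obtain v where v: "v \<in> F" "neighbors G v - F = {w}" by (auto simp: can_fill_def)
    then show "w \<in> ?P \<union> ?Q"
      by (cases "v \<in> L") (auto intro!: image_eqI[of _ _ v])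
  qed
  have same: "neighbors G v - F = neighbors G v' - F" if "v \<in> F \<inter> L" "v' \<in> F \<inter> L" for v v'
  proof -
    have "(v, x) \<in> parcs G \<longleftrightarrow> (v', x) \<in> parcs G" if "x \<notin> F" for x
    proof -
      have "(x, v) \<in> parcs G \<longleftrightarrow> (x, v') \<in> parcs G"
      proof -
        have "x \<noteq> v" "x \<noteq> v'" "v \<in> L" "v' \<in> L"
          using that \<open>v \<in> F \<inter> L\<close> \<open>v' \<in> F \<inter> L\<close> by auto
        then show ?thesis
          using twin unfolding twin_set_def by blast
      qed
      then show ?thesis using arcs_symmetric by blast
    qed
    then show ?thesis by (auto simp: neighbors_def)
  qed
  obtain w where w: "?P \<subseteq> {w}"
  proof (cases "F \<inter> L = {}")
    case True
    then show thesis using that[of undefined] by simp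
  next
    case False
    then obtain v where v: "v \<in> F \<inter> L" by blast
    have "?P \<subseteq> {the_elem (neighbors G v - F)}"
    proof
      fix x assume "x \<in> ?P"
      then obtain v' where v': "v' \<in> F \<inter> L" "neighbors G v' - F = {x}" by blast
      show "x \<in> {the_elem (neighbors G v - F)}"
        unfolding same[OF v v'(1)] v'(2) by simp
    qed
    then show thesis by (rule that)
  qed
  from w have finP: "finite ?P" by (rule finite_subset) simp
  from w have cardP: "card ?P \<le> 1" using card_mono[of "{w}" ?P] by simp
  show "finite {w. can_fill G F w}"
    using sub finP finF by (auto intro: finite_subset[OF sub])
  have "card {w. can_fill G F w} \<le> card (?P \<union> ?Q)"
    using sub finP finF by (intro card_mono) auto
  also have "\<dots> \<le> card ?P + card ?Q" by (rule card_Un_le)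
  also have "\<dots> \<le> 1 + card (F - L)"
    using cardP finF by (intro add_mono card_image_le) auto
  finally show "card {w. can_fill G F w} \<le> 1 + card (F - L)" .
qed

text \<open>At most one vertex of \<open>L\<close> is ever unfilled, and only three vertices lie
  outside \<open>L\<close>. Unfilled vertices among these three cannot force, so many unfilled
  vertices mean few forces in the next round; this bounds how many can be missing at the start if
  \<open>t\<close> rounds suffice.\<close>

lemma twin_forcing_bounds:
  assumes "pair_graph G" and twin: "twin_set G L" and three: "card (pverts G - L) = 3"
    and B: "B \<subseteq> pverts G" and full: "filled_after G B t = pverts G"
  shows "card (pverts G - B) \<le> 4" "card (pverts G - B) \<le> t + 1" "t = 0 \<Longrightarrow> B = pverts G"
proof -
  interpret pair_graph G by fact
  let ?V = "pverts G" and ?F = "filled_after G B"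
  note fin = pair_finite_verts
  have LV: "L \<subseteq> ?V" using twin by (simp add: twin_set_def)
  have "a = b" if "a \<in> L - B" "b \<in> L - B" for a b
    using twins_stay_unfilled[OF twin, of a b B t] full that LV by blast
  then have LB: "card (L - B) \<le> 1"
    using fin LV by (subst One_nat_def, subst card_le_Suc0_iff_eq) (auto intro: finite_subset)
  have split: "card (?V - ?F i) = card (L - ?F i) + card (?V - L - ?F i)" for i
    using fin LV by (subst card_Un_disjoint[symmetric]) (auto intro: finite_subset arg_cong[of _ _ card])
  have LF: "card (L - ?F i) \<le> 1" for i
  proof -
    have "card (L - ?F i) \<le> card (L - B)"
      using filled_after_mono[of B G i] fin LV by (intro card_mono) (auto intro: finite_subset)
    then show ?thesis using LB by simp
  qed
  \<comment> \<open>Let \<open>u\<close> vertices be unfilled, \<open>r\<close> of them outside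
    \<open>L\<close>. A round fills at most \<open>1 + (3 - r)\<close> vertices, and
    \<open>r\<close> is at least \<open>u - 1\<close>, so at most \<open>5 - u\<close> are
    filled.\<close>
  have step: "2 * card (?V - ?F i) \<le> card (?V - ?F (Suc i)) + 5" for i
  proof -
    let ?W = "{w. can_fill G (?F i) w}"
    note sub = filled_after_subset[OF \<open>pair_graph G\<close> B, of i]
    note W = card_can_fill_le[OF \<open>pair_graph G\<close> twin sub]
    have "?V - ?F i \<subseteq> (?V - ?F (Suc i)) \<union> ?W" by auto
    then have "card (?V - ?F i) \<le> card ((?V - ?F (Suc i)) \<union> ?W)"
      using fin W(1) by (intro card_mono) auto
    also have "\<dots> \<le> card (?V - ?F (Suc i)) + card ?W" by (rule card_Un_le)
    finally have "card (?V - ?F i) \<le> card (?V - ?F (Suc i)) + (1 + card (?F i - L))"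
      using W(2) by simp
    moreover have "card (?F i - L) + card (?V - L - ?F i) = 3"
    proof -
      have "(?F i - L) \<union> (?V - L - ?F i) = ?V - L" using sub by auto
      then show ?thesis
        using three fin sub
        by (subst card_Un_disjoint[symmetric]) (auto intro: finite_subset)
    qed
    ultimately show ?thesis using split[of i] LF[of i] by simp
  qed
  have four: "card (?V - ?F i) \<le> 4" for i
  proof -
    have "card (?V - L - ?F i) \<le> 3" unfolding three[symmetric] using fin by (intro card_mono) auto
    then show ?thesis using split[of i] LF[of i] by simp
  qed
  from four[of 0] show "card (?V - B) \<le> 4" by simp
  have final: "card (?V - ?F t) = 0" using full by simp
  have first: "2 * card (?V - B) \<le> card (?V - ?F 1) + 5"
    using step[of 0] by simp
  have second: "2 * card (?V - ?F 1) \<le> card (?V - ?F 2) + 5"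
    using step[of 1] unfolding Suc_1 .
  \<comment> \<open>Going back from no unfilled vertex, the recurrence allows at most 2 one round
    earlier and at most 3 two rounds earlier; from three rounds on the bound 4 is enough.\<close>
  consider "t = 0" | "t = 1" | "t = 2" | "t \<ge> 3" by linarith
  then show "card (?V - B) \<le> t + 1"
  proof cases
    case 1
    then show ?thesis using full by simp
  next
    case 2
    show ?thesis using final first unfolding 2 by linarith
  next
    case 3
    show ?thesis using final first second unfolding 3 by linarith
  next
    case 4
    then show ?thesis using four[of 0] by simp
  qed
  show "B = ?V" if "t = 0" using that full by simp
qed

section \<open>Attained minima and the lower bounds\<close>

lemma Inf_enat_in: "X \<noteq> {} \<Longrightarrow> Inf X \<in> (X :: enat set)"
  by (auto simp: Inf_enat_def intro: LeastI)

text \<open>A finite infimum over \<open>enat\<close> is attained, so a lower bound only has to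
  treat one concrete forcing set and one time.\<close>

lemma pt_cases:
  obtains "pt G k = \<infinity>"
  | B t where "B \<subseteq> pverts G" "card B = k" "filled_after G B t = pverts G" "pt G k = enat t"
proof (cases "pt G k = \<infinity>")
  case False
  then have "{B. B \<subseteq> pverts G \<and> card B = k} \<noteq> {}"
    unfolding pt_def by (metis Inf_empty image_empty top_enat_def)
  then have "pt G k \<in> pt_set G ` {B. B \<subseteq> pverts G \<and> card B = k}"
    unfolding pt_def by (intro Inf_enat_in) simp
  then obtain B where B: "B \<subseteq> pverts G" "card B = k" "pt G k = pt_set G B"
    by auto
  with False have "{t. filled_after G B t = pverts G} \<noteq> {}"
    unfolding pt_set_def by (metis Inf_empty image_empty top_enat_def)
  then have "pt_set G B \<in> enat ` {t. filled_after G B t = pverts G}"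
    unfolding pt_set_def by (intro Inf_enat_in) simp
  then show thesis using B that(2) by auto
qed (use that in blast)

text \<open>With \<open>u\<close> initially unfilled vertices, the bound
  \<open>u \<le> t + 1\<close> gives the sum at once. The product also uses \<open>u \<le> 4\<close>
  and reduces to four values of \<open>u\<close>.\<close>

lemma twin_th_ge:
  assumes G: "pair_graph G" and twin: "twin_set G L" "card (pverts G - L) = 3"
    and n: "card (pverts G) = n" "n \<ge> 5"
  shows "enat (n - 1) \<le> th G" "enat (n - 2) \<le> th_star G"
proof -
  interpret pair_graph G by fact
  have card_diff: "card (pverts G - B) = n - card B" if "B \<subseteq> pverts G" for B
    using that n pair_finite_verts by (simp add: card_Diff_subset finite_subset)
  show "enat (n - 1) \<le> th G"
    unfolding th_def
  proof (rule INF_greatest)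
    fix k
    show "enat (n - 1) \<le> enat k + pt G k"
    proof (cases rule: pt_cases[of G k])
      case (2 B t)
      then show ?thesis
        using twin_forcing_bounds(2)[OF G twin 2(1,3)] card_diff[OF 2(1)] by simp
    qed simp
  qed
  show "enat (n - 2) \<le> th_star G"
    unfolding th_star_def
  proof (rule INF_greatest)
    fix k assume k: "k \<in> {1..card (pverts G) - 1}"
    show "enat (n - 2) \<le> enat k * pt G k"
    proof (cases rule: pt_cases[of G k])
      case 1
      \<comment> \<open>Here \<open>k \<ge> 1\<close> matters, since zero times infinity is zero in
        \<open>enat\<close>.\<close>
      then show ?thesis using k by (simp add: zero_enat_def)
    next
      case (2 B t)
      define u where "u = n - k"
      have u: "u \<le> 4" "u \<le> t + 1" "k = n - u" "u \<ge> 1"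
        using twin_forcing_bounds(1,2)[OF G twin 2(1,3)] card_diff[OF 2(1)] 2(2) k n
        by (auto simp: u_def)
      \<comment> \<open>Time zero would require all \<open>n\<close> vertices in \<open>B\<close>,
        but \<open>k\<close> is at most \<open>n - 1\<close>; this is where the exclusion of
        \<open>k = n\<close> enters.\<close>
      have "t \<ge> 1"
        using twin_forcing_bounds(3)[OF G twin 2(1,3)] 2(2) k n by (cases t) auto
      then have t: "max 1 (u - 1) \<le> t" using u by simp
      \<comment> \<open>The products are \<open>n - 1\<close>, \<open>n - 2\<close>,
        \<open>2 * (n - 3)\<close> and \<open>3 * (n - 4)\<close>. The last one reaches
        \<open>n - 2\<close> exactly from \<open>n = 5\<close> on.\<close>
      have "u = 1 \<or> u = 2 \<or> u = 3 \<or> u = 4" using u by auto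
      then have "n - 2 \<le> (n - u) * max 1 (u - 1)" using n(2) by auto
      also have "\<dots> \<le> k * t" using t u by (intro mult_mono) auto
      finally show ?thesis using 2 by simp
    qed
  qed
qed

section \<open>Blown-up paths\<close>

text \<open>Edges are listed in one direction only, away from the end 0; \<open>blown_path\<close>
  symmetrizes. The vertices from 3 on are the copies of the fourth path vertex.\<close>

definition path_edge :: "nat \<Rightarrow> nat \<Rightarrow> bool" where
  "path_edge u v \<longleftrightarrow> u = 0 \<and> v = 1 \<or> u = 1 \<and> v = 2 \<or> u = 2 \<and> v \<ge> 3"

definition blown_path :: "nat \<Rightarrow> nat pair_pre_digraph" where
  "blown_path n = \<lparr> pverts = {..<n},
    parcs = {(u, v). u < n \<and> v < n \<and> (path_edge u v \<or> path_edge v u)} \<rparr>"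

lemma pair_graph_blown_path: "pair_graph (blown_path n)"
proof -
  have "parcs (blown_path n) \<subseteq> {..<n} \<times> {..<n}" by (auto simp: blown_path_def)
  then have "finite (parcs (blown_path n))" using finite_subset by blast
  then show ?thesis
    by unfold_locales (auto simp: blown_path_def path_edge_def symmetric_def sym_def)
qed

text \<open>In the graph, every vertex other than 0 is 2 or adjacent to 2, and 0 gets there through
  1. In the complement, 0 is adjacent to all vertices but 1, and 1 gets there through 3.\<close>

lemma co_connected_blown_path:
  assumes "n \<ge> 5"
  shows "co_connected_graph (blown_path n)"
  unfolding co_connected_graph_def
proof (intro conjI)
  show "pair_graph (blown_path n)" by (rule pair_graph_blown_path)
  show "connected (with_proj (blown_path n))"
  proof (rule connected_pair_graphI[OF pair_graph_blown_path, of 2])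
    fix v assume v: "v \<in> pverts (blown_path n)"
    have adj: "(i, 2) \<in> parcs (blown_path n)" if "i = 1 \<or> i \<ge> 3" "i < n" for i
      using that assms by (auto simp: blown_path_def path_edge_def)
    have "(0, 1) \<in> parcs (blown_path n)"
      using assms by (auto simp: blown_path_def path_edge_def)
    then have "(0, 2) \<in> (parcs (blown_path n))\<^sup>*"
      using adj[of 1] assms by (meson converse_rtrancl_into_rtrancl less_le_trans one_less_numeral_iff r_into_rtrancl semiring_norm(77))
    moreover have "v = 0 \<or> v = 2 \<or> v = 1 \<or> v \<ge> 3" by linarith
    ultimately show "(v, 2) \<in> (parcs (blown_path n))\<^sup>*"
      using adj[of v] v by (auto simp: blown_path_def)
  qed (use assms in \<open>simp add: blown_path_def\<close>)
  show "connected (with_proj (graph_complement (blown_path n)))"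
  proof (rule connected_pair_graphI[OF pair_graph_complement[OF pair_graph_blown_path], of 0])
    let ?E = "parcs (graph_complement (blown_path n))"
    fix v assume v: "v \<in> pverts (graph_complement (blown_path n))"
    have adj: "(i, 0) \<in> ?E" if "i \<ge> 2" "i < n" for i
      using that by (auto simp: blown_path_def path_edge_def graph_complement_def)
    have "(1, 3) \<in> ?E"
      using assms by (auto simp: blown_path_def path_edge_def graph_complement_def)
    then have "(1, 0) \<in> ?E\<^sup>*"
      using adj[of 3] assms by (auto intro: converse_rtrancl_into_rtrancl)
    moreover have "v = 0 \<or> v = 1 \<or> v \<ge> 2" by linarith
    ultimately show "(v, 0) \<in> ?E\<^sup>*"
      using adj[of v] v by (auto simp: blown_path_def graph_complement_def)
  qed (use assms in \<open>simp add: blown_path_def graph_complement_def\<close>)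
qed

lemma blown_path_twins:
  assumes "n \<ge> 3"
  shows "twin_set (blown_path n) {3..<n}" "card (pverts (blown_path n) - {3..<n}) = 3"
proof -
  show "twin_set (blown_path n) {3..<n}"
    by (auto simp: twin_set_def blown_path_def path_edge_def)
  have "pverts (blown_path n) - {3..<n} = {..<3}"
    using assms by (auto simp: blown_path_def)
  then show "card (pverts (blown_path n) - {3..<n}) = 3" by simp
qed

text \<open>The same twin set serves the graph and its complement, so the lower bounds apply to both
  and meet the general upper bounds.\<close>

lemma blown_path_th_eq:
  assumes "n \<ge> 5"
  shows "th (blown_path n) = enat (n - 1)" "th (graph_complement (blown_path n)) = enat (n - 1)"
    and "th_star (blown_path n) = enat (n - 2)"
    and "th_star (graph_complement (blown_path n)) = enat (n - 2)"
proof -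
  let ?G = "blown_path n"
  let ?L = "{3..<n}"
  have card: "card (pverts ?G) = n" "card (pverts (graph_complement ?G)) = n"
    by (auto simp: blown_path_def graph_complement_def)
  have L: "twin_set ?G ?L" "card (pverts ?G - ?L) = 3"
    using blown_path_twins assms by auto
  have L': "twin_set (graph_complement ?G) ?L" "card (pverts (graph_complement ?G) - ?L) = 3"
    using twin_set_complement[OF L(1)] L(2) by (auto simp: graph_complement_def)
  note up = co_connected_th_le[OF co_connected_blown_path[OF assms] card(1)]
  note lo = twin_th_ge[OF pair_graph_blown_path L card(1) assms]
  note lo' = twin_th_ge[OF pair_graph_complement[OF pair_graph_blown_path] L' card(2) assms]
  show "th ?G = enat (n - 1)" "th (graph_complement ?G) = enat (n - 1)"
    "th_star ?G = enat (n - 2)" "th_star (graph_complement ?G) = enat (n - 2)"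
    using up lo lo' assms by (auto intro: antisym)
qed

text \<open>An isomorphism preserves the order, and distinct members of the family have distinct
  orders.\<close>

lemma infinitely_many_blown_paths:
  assumes "\<And>n. n \<ge> 5 \<Longrightarrow> P (blown_path n)"
  shows "infinitely_many_graphs P"
  unfolding infinitely_many_graphs_def
proof (intro exI conjI ballI impI)
  have "inj blown_path"
    by (rule injI) (simp add: blown_path_def)
  then show "infinite (blown_path ` {5..})"
    by (simp add: finite_image_iff inj_on_subset infinite_Ici)
  show "P G" if "G \<in> blown_path ` {5..}" for G
    using that assms by auto
  fix G H assume "G \<in> blown_path ` {5..}" "H \<in> blown_path ` {5..}" and ne: "G \<noteq> H"
  then obtain m n where mn: "G = blown_path m" "H = blown_path n" by auto
  show "\<not> digraph_iso (with_proj G) (with_proj H)"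
  proof
    assume "digraph_iso (with_proj G) (with_proj H)"
    then obtain f where f: "pre_digraph.digraph_isomorphism (with_proj G) f"
      "with_proj H = app_iso f (with_proj G)"
      by (auto simp: digraph_iso_def)
    from f(1) have "inj_on (iso_verts f) (pverts G)"
      by (simp add: pre_digraph.digraph_isomorphism_def)
    moreover from f(2) have "pverts H = iso_verts f ` pverts G"
      by (metis verts_app_iso with_proj_simps(1))
    ultimately have "card (pverts H) = card (pverts G)"
      by (simp add: card_image)
    then show False using mn ne by (simp add: blown_path_def)
  qed
qed

theorem proposition2p5:
  shows "(\<forall>(G :: 'a pair_pre_digraph) n.
      co_connected_graph G \<and> card (pverts G) = n \<and> n \<ge> 4 \<longrightarrow>
        th G + th (graph_complement G) \<le> enat (2 * (n - 1)) \<and>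
        th G * th (graph_complement G) \<le> enat ((n - 1)\<^sup>2) \<and>
        th_star G + th_star (graph_complement G) \<le> enat (2 * (n - 2)) \<and>
        th_star G * th_star (graph_complement G) \<le> enat ((n - 2)\<^sup>2))
    \<and> infinitely_many_graphs (\<lambda>G. co_connected_graph G \<and> card (pverts G) \<ge> 4 \<and>
        th G + th (graph_complement G) = enat (2 * (card (pverts G) - 1)))
    \<and> infinitely_many_graphs (\<lambda>G. co_connected_graph G \<and> card (pverts G) \<ge> 4 \<and>
        th G * th (graph_complement G) = enat ((card (pverts G) - 1)\<^sup>2))
    \<and> infinitely_many_graphs (\<lambda>G. co_connected_graph G \<and> card (pverts G) \<ge> 4 \<and>
        th_star G + th_star (graph_complement G) = enat (2 * (card (pverts G) - 2)))
    \<and> infinitely_many_graphs (\<lambda>G. co_connected_graph G \<and> card (pverts G) \<ge> 4 \<and>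
        th_star G * th_star (graph_complement G) = enat ((card (pverts G) - 2)\<^sup>2))"
proof -
  have upper: "th G + th (graph_complement G) \<le> enat (2 * (n - 1)) \<and>
      th G * th (graph_complement G) \<le> enat ((n - 1)\<^sup>2) \<and>
      th_star G + th_star (graph_complement G) \<le> enat (2 * (n - 2)) \<and>
      th_star G * th_star (graph_complement G) \<le> enat ((n - 2)\<^sup>2)"
    if "co_connected_graph G" "card (pverts G) = n" "n \<ge> 4" for G :: "'a pair_pre_digraph" and n
  proof -
    \<comment> \<open>Written as a sum or product of two equal terms, each bound follows by
      monotonicity from the separate bounds on the graph and its complement.\<close>
    have double: "enat (2 * m) = enat m + enat m" and square: "enat (m\<^sup>2) = enat m * enat m" for m
      by (simp_all add: power2_eq_square)
    show ?thesis
      unfolding double square using co_connected_th_le[OF that]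
      by (intro conjI add_mono mult_mono) auto
  qed
  have card: "card (pverts (blown_path n)) = n" for n
    by (simp add: blown_path_def)
  show ?thesis
  proof (rule conjI, intro allI impI)
    fix G :: "'a pair_pre_digraph" and n
    assume "co_connected_graph G \<and> card (pverts G) = n \<and> n \<ge> 4"
    then show "th G + th (graph_complement G) \<le> enat (2 * (n - 1)) \<and>
        th G * th (graph_complement G) \<le> enat ((n - 1)\<^sup>2) \<and>
        th_star G + th_star (graph_complement G) \<le> enat (2 * (n - 2)) \<and>
        th_star G * th_star (graph_complement G) \<le> enat ((n - 2)\<^sup>2)"
      using upper by blast
  qed (intro conjI infinitely_many_blown_paths;
      simp add: card co_connected_blown_path blown_path_th_eq power2_eq_square)
qed

end
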